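(* Let $P(\lambda)=\sum_{j=0}^m A_j\lambda^j$ be an $n\times n$ matrix polynomial with $A_j\in\mathbb{C}^{n\times n}$, $m\ge 1$ and $\det A_m\ne 0$, and let $w_0>0$, $w_1,\dots,w_m\ge 0$ be given weights. Let $\lambda_0\in\sigma(P)\setminus\sigma(P')$ be a simple eigenvalue of $P(\lambda)$, and let $y_0,x_0\in\mathbb{C}^n$ be corresponding left and right unit eigenvectors, respectively. If the vector $[P'(\lambda_0)]^*y_0$ is not a scalar multiple of $x_0$, then $$\mathrm{dist}(P,\lambda_0)\ \le\ \frac{c(P'(\lambda_0))\,\|P(\lambda_0)\|}{k(P,\lambda_0)\left(\|y_0^*P'(\lambda_0)\|^2-|y_0^*P'(\lambda_0)x_0|^2\right)^{1/2}}.$$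
   Context: $\|\cdot\|$ is the spectral matrix norm (Euclidean norm for vectors). $P'(\lambda)$ is the derivative of $P(\lambda)$ with respect to $\lambda$. For a matrix polynomial $R(\lambda)$, $\sigma(R)=\{\lambda\in\mathbb{C}:\det R(\lambda)=0\}$; thus $\lambda_0\notin\sigma(P')$ means that $P'(\lambda_0)$ is invertible. A right (left) eigenvector of $P$ for $\lambda_0$ is a nonzero $x_0$ with $P(\lambda_0)x_0=0$ (a nonzero $y_0$ with $y_0^*P(\lambda_0)=0$); unit means Euclidean norm $1$. The algebraic multiplicity of an eigenvalue is its multiplicity as a zero of the determinant of the matrix polynomial; an eigenvalue is simple if this multiplicity is $1$ and multiple if it is at least $2$ (i.e. the determinant and its first derivative both vanish there). For an invertible matrix $A$, $c(A)=\|A\|\,\|A^{-1}\|$. Let $w(\lambda)=w_m\lambda^m+\cdots+w_1\lambda+w_0$. The condition number of the simple eigenvalue $\lambda_0$ with right and left eigenvectors $x_0,y_0$ is $$k(P,\lambda_0)=\frac{w(|\lambda_0|)\,\|x_0\|\,\|y_0\|}{|y_0^*P'(\lambda_0)x_0|}.$$ For $\varepsilon>0$, with $\mathrm{w}=\{w_0,\dots,w_m\}$, let $\mathcal{B}(P,\varepsilon,\mathrm{w})$ be the set of matrix polynomials $Q(\lambda)=\sum_{j=0}^m(A_j+\Delta_j)\lambda^j$, $\Delta_j\in\mathbb{C}^{n\times n}$, with $\|\Delta_j\|\le\varepsilon w_j$ for $j=0,1,\dots,m$. Then $$\mathrm{dist}(P,\lambda_0)=\inf\{\varepsilon>0:\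 \exists\,Q(\lambda)\in\mathcal{B}(P,\varepsilon,\mathrm{w})\text{ with }\lambda_0\text{ as a multiple eigenvalue}\}.$$ *)

theory Defs
  imports "HOL-Analysis.Analysis" "HOL-Computational_Algebra.Polynomial"
begin

text \<open>An \<open>n \<times> n\<close> complex matrix polynomial is a matrix with entries in \<open>complex poly\<close>;
  \<open>matpoly m A\<close> is the polynomial with coefficient matrices \<open>A 0, \<dots>, A m\<close>
  (values of \<open>A\<close> beyond \<open>m\<close> are ignored).\<close>

definition matpoly :: "nat \<Rightarrow> (nat \<Rightarrow> complex^'n^'n) \<Rightarrow> (complex poly)^'n^'n" where
  "matpoly m A = (\<chi> i k. \<Sum>j\<le>m. monom (A j $ i $ k) j)"

definition mp_eval :: "(complex poly)^'n^'n \<Rightarrow> complex \<Rightarrow> complex^'n^'n" where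
  "mp_eval P z = (\<chi> i k. poly (P $ i $ k) z)"

definition mp_deriv :: "(complex poly)^'n^'n \<Rightarrow> (complex poly)^'n^'n" where
  "mp_deriv P = (\<chi> i k. pderiv (P $ i $ k))"

definition mp_spectrum :: "(complex poly)^'n^'n \<Rightarrow> complex set" where
  "mp_spectrum P = {z. det (mp_eval P z) = 0}"

text \<open>Multiplicity of \<open>z\<close> as a zero of the determinant. If the determinant vanishes identically,
  all its derivatives vanish at \<open>z\<close>, so the multiplicity is \<open>\<infinity>\<close>; perturbed matrix
  polynomials may be of this kind.\<close>

definition alg_multiplicity :: "(complex poly)^'n^'n \<Rightarrow> complex \<Rightarrow> enat" where
  "alg_multiplicity P z = (if det P = 0 then \<infinity> else enat (order z (det P)))"

definition simple_eigenvalue :: "(complex poly)^'n^'n \<Rightarrow> complex \<Rightarrow> bool" where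
  "simple_eigenvalue P z \<longleftrightarrow> alg_multiplicity P z = 1"

definition multiple_eigenvalue :: "(complex poly)^'n^'n \<Rightarrow> complex \<Rightarrow> bool" where
  "multiple_eigenvalue P z \<longleftrightarrow> alg_multiplicity P z \<ge> 2"

lemma det_mp_eval: "det (mp_eval P z) = poly (det P) z"
  by (simp add: det_def mp_eval_def poly_sum poly_prod)

lemma multiple_eigenvalue_iff:
  "multiple_eigenvalue P z \<longleftrightarrow> poly (det P) z = 0 \<and> poly (pderiv (det P)) z = 0"
proof (cases "det P = 0")
  case True
  then show ?thesis by (simp add: multiple_eigenvalue_def alg_multiplicity_def)
next
  case False
  have two: "2 \<le> enat k \<longleftrightarrow> 2 \<le> k" for k
    by (simp add: numeral_eq_enat)
  have "poly (det P) z = 0 \<and> poly (pderiv (det P)) z = 0 \<longleftrightarrow> 2 \<le> order z (det P)"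
  proof (cases "order z (det P) = 0")
    case True
    then show ?thesis using False order_root[of "det P" z] by simp
  next
    case nz: False
    then have root: "poly (det P) z = 0" using False order_root[of "det P" z] by simp
    have pd: "pderiv (det P) \<noteq> 0"
    proof
      assume "pderiv (det P) = 0"
      then obtain c where "det P = [:c:]" using pderiv_iszero by blast
      then show False using root False by simp
    qed
    have "order z (det P) = Suc (order z (pderiv (det P)))"
      by (rule order_pderiv[OF False root])
    then show ?thesis
      using root pd order_root[of "pderiv (det P)" z] by (simp add: Suc_le_eq)
  qed
  then show ?thesis
    using False by (simp add: multiple_eigenvalue_def alg_multiplicity_def two)
qed

text \<open>The norm of the type \<open>complex^'n\<close> is the Euclidean one, so the operator norm is the
  spectral norm. (The library's \<open>norm\<close> on \<open>complex^'n^'n\<close> is the Frobenius norm.)\<close>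

definition spectral_norm :: "complex^'n^'n \<Rightarrow> real" where
  "spectral_norm A = onorm (\<lambda>x. A *v x)"

definition matrix_cond :: "complex^'n^'n \<Rightarrow> real" where
  "matrix_cond A = spectral_norm A * spectral_norm (matrix_inv A)"

definition vec_cnj :: "complex^'n \<Rightarrow> complex^'n" where
  "vec_cnj y = (\<chi> i. cnj (y $ i))"

definition adjoint_mat :: "complex^'n^'n \<Rightarrow> complex^'n^'n" where
  "adjoint_mat A = (\<chi> i k. cnj (A $ k $ i))"

text \<open>The row vector \<open>y\<^sup>* A\<close> and the scalar \<open>y\<^sup>* A x\<close>.\<close>

definition star_mult :: "complex^'n \<Rightarrow> complex^'n^'n \<Rightarrow> complex^'n" where
  "star_mult y A = vec_cnj y v* A"

definition sesq_form :: "complex^'n \<Rightarrow> complex^'n^'n \<Rightarrow> complex^'n \<Rightarrow> complex" where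
  "sesq_form y A x = (\<Sum>i\<in>UNIV. star_mult y A $ i * x $ i)"

definition right_eigenvector :: "(complex poly)^'n^'n \<Rightarrow> complex \<Rightarrow> complex^'n \<Rightarrow> bool" where
  "right_eigenvector P z x \<longleftrightarrow> x \<noteq> 0 \<and> mp_eval P z *v x = 0"

definition left_eigenvector :: "(complex poly)^'n^'n \<Rightarrow> complex \<Rightarrow> complex^'n \<Rightarrow> bool" where
  "left_eigenvector P z y \<longleftrightarrow> y \<noteq> 0 \<and> star_mult y (mp_eval P z) = 0"

definition weight_poly :: "nat \<Rightarrow> (nat \<Rightarrow> real) \<Rightarrow> real \<Rightarrow> real" where
  "weight_poly m w t = (\<Sum>j\<le>m. w j * t ^ j)"

definition eig_cond ::
  "nat \<Rightarrow> (nat \<Rightarrow> real) \<Rightarrow> (complex poly)^'n^'n \<Rightarrow> complex \<Rightarrow> complex^'n \<Rightarrow> complex^'n \<Rightarrow> real" where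
  "eig_cond m w P z x y =
     weight_poly m w (cmod z) * norm x * norm y / cmod (sesq_form y (mp_eval (mp_deriv P) z) x)"

definition pert_ball ::
  "nat \<Rightarrow> (nat \<Rightarrow> complex^'n^'n) \<Rightarrow> real \<Rightarrow> (nat \<Rightarrow> real) \<Rightarrow> ((complex poly)^'n^'n) set" where
  "pert_ball m A \<epsilon> w =
     {matpoly m (\<lambda>j. A j + \<Delta> j) | \<Delta>. \<forall>j\<le>m. spectral_norm (\<Delta> j) \<le> \<epsilon> * w j}"

text \<open>Taken in \<open>ereal\<close>, so that the infimum of the empty set is \<open>\<infinity>\<close>.\<close>

definition dist_multiple ::
  "nat \<Rightarrow> (nat \<Rightarrow> complex^'n^'n) \<Rightarrow> (nat \<Rightarrow> real) \<Rightarrow> complex \<Rightarrow> ereal" where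
  "dist_multiple m A w z =
     (INF \<epsilon> \<in> {\<epsilon>. \<epsilon> > 0 \<and> (\<exists>Q \<in> pert_ball m A \<epsilon> w. multiple_eigenvalue Q z)}. ereal \<epsilon>)"

end

theory Submission
  imports Defs
begin

text \<open>
  Write \<open>B = P(\<lambda>\<^sub>0)\<close>, \<open>C = P'(\<lambda>\<^sub>0)\<close>, \<open>a = y\<^sub>0\<^sup>* C\<close> and \<open>\<beta> = a x\<^sub>0\<close>. The derivative of the
  determinant vanishes at an eigenvalue as soon as some right eigenvector \<open>v\<close> and left
  eigenvector \<open>y\<close> satisfy \<open>y\<^sup>* C v = 0\<close> (\<open>multiple_eigenvalueI\<close>). So keep the left eigenvector
  \<open>y\<^sub>0\<close> and tilt the right one: the projection \<open>v = x\<^sub>0 - (\<beta> / \<parallel>a\<parallel>\<^sup>2) a\<^sup>*\<close> of \<open>x\<^sub>0\<close> onto the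
  orthogonal complement of \<open>a\<^sup>*\<close> satisfies \<open>a v = 0\<close>, and it is nonzero because
  \<open>a\<^sup>* = C\<^sup>* y\<^sub>0\<close> is not a multiple of \<open>x\<^sub>0\<close>.

  The rank-one matrix \<open>E = - B v v\<^sup>* / \<parallel>v\<parallel>\<^sup>2\<close> makes \<open>v\<close> a null vector of \<open>B + E\<close>, and
  \<open>y\<^sub>0\<^sup>* E = 0\<close> since \<open>y\<^sub>0\<^sup>* B = 0\<close>. Hence adding \<open>g(\<lambda>) E\<close> to \<open>P\<close>, for any scalar polynomial
  \<open>g\<close> with \<open>g(\<lambda>\<^sub>0) = 1\<close>, keeps \<open>y\<^sub>0\<close> as left eigenvector, makes \<open>v\<close> a right eigenvector, and
  leaves the row \<open>y\<^sub>0\<^sup>* P'(\<lambda>\<^sub>0)\<close> unchanged, so \<open>\<lambda>\<^sub>0\<close> becomes multiple. Distributing \<open>E\<close> over the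
  coefficients in proportion to the weights, with phases that align the powers of \<open>\<lambda>\<^sub>0\<close>, costs
  only \<open>\<epsilon> = \<parallel>E\<parallel> / w(|\<lambda>\<^sub>0|)\<close> (\<open>matpoly_with_multiple_eigenvalue_nearby\<close>).

  As \<open>B x\<^sub>0 = 0\<close>, the vector \<open>B v\<close> is \<open>- (\<beta> / \<parallel>a\<parallel>\<^sup>2) B a\<^sup>*\<close>, and \<open>\<parallel>a\<parallel>\<^sup>2 \<parallel>v\<parallel>\<^sup>2 = \<parallel>a\<parallel>\<^sup>2 - |\<beta>|\<^sup>2\<close>. Thus
  \<open>\<parallel>E\<parallel> \<le> \<parallel>B v\<parallel> / \<parallel>v\<parallel> \<le> |\<beta>| \<parallel>B\<parallel> / (\<parallel>a\<parallel>\<^sup>2 - |\<beta>|\<^sup>2)\<^bsup>1/2\<^esup>\<close>, and dividing by \<open>w(|\<lambda>\<^sub>0|)\<close> gives the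
  bound, because \<open>c(C) \<ge> 1\<close>.
\<close>

section \<open>Determinants with a nearly null row and column\<close>

text \<open>Adding multiples of the other rows to the scaled row \<open>k\<close> only multiplies the determinant by
  the scaling factor. No division is involved, so this applies to matrices of polynomials.\<close>

lemma det_row_combination:
  fixes A :: "'a::comm_ring_1^'n^'n"
  shows "det (\<chi> i. if i = k then c v* A else A $ i) = c $ k * det A"
proof -
  have "c v* A = (\<Sum>j\<in>UNIV. c $ j *s A $ j)"
    by (simp add: vec_eq_iff vector_matrix_mult_def sum_component)
  then have "det (\<chi> i. if i = k then c v* A else A $ i)
      = (\<Sum>j\<in>UNIV. det (\<chi> i. if i = k then c $ j *s A $ j else A $ i))"
    using det_linear_row_sum [where a = "\<lambda>_ j. c $ j *s A $ j" and c = "\<lambda>i. A $ i" and k = k]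
    by (simp cong: if_cong)
  also have "\<dots> = (\<Sum>j\<in>UNIV. c $ j * det (\<chi> i. if i = k then A $ j else A $ i))"
    by (simp add: det_row_mul)
  also have "\<dots> = (\<Sum>j\<in>UNIV. if j = k then c $ j * det A else 0)"
  proof (rule sum.cong [OF refl])
    fix j
    show "c $ j * det (\<chi> i. if i = k then A $ j else A $ i) = (if j = k then c $ j * det A else 0)"
    proof (cases "j = k")
      case True
      then have "(\<chi> i. if i = k then A $ j else A $ i) = A"
        by (simp add: vec_eq_iff)
      with True show ?thesis by simp
    next
      case False
      then have "det (\<chi> i. if i = k then A $ j else A $ i) = 0"
        by (intro det_identical_rows [of j k]) (simp_all add: row_def vec_eq_iff)
      with False show ?thesis by simp
    qed
  qed
  finally show ?thesis by simp
qed

lemma det_column_combination: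
  fixes A :: "'a::comm_ring_1^'n^'n"
  shows "det (\<chi> i j. if j = k then (A *v c) $ i else A $ i $ j) = c $ k * det A"
proof -
  have "(\<chi> i j. if j = k then (A *v c) $ i else A $ i $ j)
      = transpose (\<chi> i. if i = k then c v* transpose A else transpose A $ i)"
    by (simp add: vec_eq_iff transpose_def matrix_vector_mult_def vector_matrix_mult_def mult_ac
        del: vector_transpose_matrix)
  then show ?thesis
    by (simp add: det_row_combination del: vector_transpose_matrix)
qed

text \<open>A term of the Leibniz expansion either uses the entry in the corner of the row and the
  column, or it uses one entry of the row and a different one of the column.\<close>

lemma square_dvd_det:
  fixes A :: "'a::comm_ring_1^'n^'n"
  assumes row: "\<And>j. p dvd A $ k $ j" and col: "\<And>i. p dvd A $ i $ l"
    and entry: "p\<^sup>2 dvd A $ k $ l"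
  shows "p\<^sup>2 dvd det A"
  unfolding det_def
proof (rule dvd_sum)
  fix \<pi> :: "'n \<Rightarrow> 'n"
  assume "\<pi> \<in> {\<pi>. \<pi> permutes UNIV}"
  then have \<pi>: "bij \<pi>" by (simp add: permutes_bij)
  define i where "i = inv \<pi> l"
  have i: "\<pi> i = l" by (simp add: i_def surj_f_inv_f bij_is_surj \<pi>)
  have "p\<^sup>2 dvd (\<Prod>i\<in>UNIV. A $ i $ \<pi> i)"
  proof (cases "i = k")
    case True
    then have "(\<Prod>i\<in>UNIV. A $ i $ \<pi> i) = A $ k $ l * (\<Prod>i\<in>UNIV - {k}. A $ i $ \<pi> i)"
      using i by (simp add: prod.remove [of UNIV k])
    then show ?thesis using entry by simp
  next
    case False
    have "(\<Prod>i\<in>UNIV. A $ i $ \<pi> i)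
        = A $ k $ \<pi> k * (A $ i $ l * (\<Prod>i\<in>UNIV - {k} - {i}. A $ i $ \<pi> i))"
      using False i by (simp add: prod.remove [of UNIV k] prod.remove [of "UNIV - {k}" i])
    moreover have "p * p dvd A $ k $ \<pi> k * (A $ i $ l * (\<Prod>i\<in>UNIV - {k} - {i}. A $ i $ \<pi> i))"
      by (intro mult_dvd_mono dvd_mult2 row col)
    ultimately show ?thesis by (simp add: power2_eq_square)
  qed
  then show "p\<^sup>2 dvd of_int (sign \<pi>) * (\<Prod>i\<in>UNIV. A $ i $ \<pi> i)"
    by simp
qed

text \<open>Replacing row \<open>k\<close> by the combination \<open>c v* A\<close> and then column \<open>l\<close> by the combination with
  coefficients \<open>d\<close> puts the bilinear form of \<open>c\<close> and \<open>d\<close> into the corner, and multiplies the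
  determinant by \<open>c $ k * d $ l\<close>.\<close>

lemma square_dvd_scaled_det:
  fixes A :: "'a::comm_ring_1^'n^'n"
  assumes row: "\<And>j. p dvd (c v* A) $ j" and col: "\<And>i. p dvd (A *v d) $ i"
    and form: "p\<^sup>2 dvd (\<Sum>j\<in>UNIV. (c v* A) $ j * d $ j)"
  shows "p\<^sup>2 dvd c $ k * (d $ l * det A)"
proof -
  define R where "R = (\<chi> i. if i = k then c v* A else A $ i)"
  define N where "N = (\<chi> i j. if j = l then (R *v d) $ i else R $ i $ j)"
  have Rd: "(R *v d) $ i = (if i = k then \<Sum>j\<in>UNIV. (c v* A) $ j * d $ j else (A *v d) $ i)" for i
    by (simp add: R_def matrix_vector_mult_def)
  have "p dvd p\<^sup>2" by (simp add: power2_eq_square)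
  then have "p dvd (\<Sum>j\<in>UNIV. (c v* A) $ j * d $ j)"
    using form dvd_trans by blast
  then have "p\<^sup>2 dvd det N"
    using row col form by (intro square_dvd_det [where k = k and l = l]) (auto simp: N_def Rd, auto simp: R_def)
  also have "det N = c $ k * (d $ l * det A)"
    by (simp add: N_def R_def det_column_combination det_row_combination mult_ac)
  finally show ?thesis .
qed

section \<open>A criterion for multiple eigenvalues\<close>

lemma square_dvd_polyI:
  fixes q :: "'a::idom poly"
  assumes "poly q z = 0" "poly (pderiv q) z = 0"
  shows "[:- z, 1:]\<^sup>2 dvd q"
proof -
  obtain r where r: "q = [:- z, 1:] * r"
    using assms(1) by (auto simp: poly_eq_0_iff_dvd)
  have "poly r z = 0"
    using assms(2) unfolding r pderiv_mult by (simp add: pderiv_pCons)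
  then show ?thesis
    unfolding r power2_eq_square by (intro mult_dvd_mono) (simp_all add: poly_eq_0_iff_dvd)
qed

lemma pderiv_sum: "pderiv (sum f S) = (\<Sum>i\<in>S. pderiv (f i))"
  using higher_pderiv_sum [of 1 f S] by simp

text \<open>Using \<open>y\<^sup>*\<close> and \<open>x\<close> as row and column combinations, the new row and column of the matrix
  polynomial vanish at \<open>z\<close>, and their common entry \<open>y\<^sup>* P(\<lambda>) x\<close> has the derivative \<open>y\<^sup>* P'(z) x = 0\<close>
  there. So \<open>(\<lambda> - z)\<^sup>2\<close> divides a nonzero multiple of the determinant.\<close>

lemma multiple_eigenvalueI:
  fixes P :: "(complex poly)^'n^'n"
  assumes x: "right_eigenvector P z x" and y: "left_eigenvector P z y"
    and yx: "sesq_form y (mp_eval (mp_deriv P) z) x = 0"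
  shows "multiple_eigenvalue P z"
proof -
  define c where "c = (\<chi> i. [:cnj (y $ i):])"
  define d where "d = (\<chi> i. [:x $ i:])"
  have evc: "poly ((c v* P) $ j) u = star_mult y (mp_eval P u) $ j" for u j
    by (simp add: c_def vector_matrix_mult_def star_mult_def vec_cnj_def mp_eval_def poly_sum)
  have evd: "poly ((P *v d) $ i) u = (mp_eval P u *v x) $ i" for u i
    by (simp add: d_def matrix_vector_mult_def mp_eval_def poly_sum mult_ac)
  have dc: "poly (pderiv ((c v* P) $ j)) z = star_mult y (mp_eval (mp_deriv P) z) $ j" for j
    by (simp add: c_def vector_matrix_mult_def star_mult_def vec_cnj_def mp_eval_def mp_deriv_def
        poly_sum pderiv_smult pderiv_sum)
  \<comment> \<open>Rows and columns at which the combinations have a nonzero, hence invertible, factor.\<close>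
  obtain k l where kl: "y $ k \<noteq> 0" "x $ l \<noteq> 0"
    using x y by (auto simp: right_eigenvector_def left_eigenvector_def vec_eq_iff)
  have row0: "star_mult y (mp_eval P z) = 0"
    using y by (simp add: left_eigenvector_def)
  have "[:- z, 1:]\<^sup>2 dvd c $ k * (d $ l * det P)"
  proof (rule square_dvd_scaled_det)
    show "[:- z, 1:] dvd (c v* P) $ j" for j
      using row0 by (simp flip: poly_eq_0_iff_dvd add: evc)
    show "[:- z, 1:] dvd (P *v d) $ i" for i
      using x by (simp flip: poly_eq_0_iff_dvd add: evd right_eigenvector_def)
    show "[:- z, 1:]\<^sup>2 dvd (\<Sum>j\<in>UNIV. (c v* P) $ j * d $ j)"
    proof (rule square_dvd_polyI)
      show "poly (\<Sum>j\<in>UNIV. (c v* P) $ j * d $ j) z = 0"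
        using row0 by (simp add: poly_sum evc)
      have "poly (pderiv (\<Sum>j\<in>UNIV. (c v* P) $ j * d $ j)) z
          = sesq_form y (mp_eval (mp_deriv P) z) x"
        by (simp add: d_def sesq_form_def dc pderiv_sum poly_sum pderiv_mult pderiv_pCons
            pderiv_smult mult_ac)
      then show "poly (pderiv (\<Sum>j\<in>UNIV. (c v* P) $ j * d $ j)) z = 0"
        using yx by simp
    qed
  qed
  also have "c $ k * (d $ l * det P) = smult (cnj (y $ k) * x $ l) (det P)"
    by (simp add: c_def d_def mult.commute)
  finally have "[:- z, 1:]\<^sup>2 dvd det P"
    using kl by (simp add: dvd_smult_iff)
  then show ?thesis
    by (auto simp: order_divides multiple_eigenvalue_def alg_multiplicity_def numeral_eq_enat)
qed

section \<open>Norms of complex vectors and matrices\<close>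

lemma norm_scaled_vec: "norm (a *s v) = cmod a * norm v" for v :: "complex^'n"
  by (simp add: norm_vec_def norm_mult L2_set_right_distrib)

lemma norm_vec_cnj: "norm (vec_cnj v) = norm v"
  by (simp add: norm_vec_def vec_cnj_def)

lemma sum_mult_cnj_eq_norm_square: "(\<Sum>i\<in>UNIV. v $ i * cnj (v $ i)) = of_real ((norm v)\<^sup>2)"
  for v :: "complex^'n"
  by (simp add: norm_vec_def L2_set_def sum_nonneg complex_norm_square [symmetric] flip: of_real_power)

lemma cmod_sum_mult_le: "cmod (\<Sum>i\<in>UNIV. a $ i * v $ i) \<le> norm a * norm v"
  for a v :: "complex^'n"
proof -
  have "cmod (\<Sum>i\<in>UNIV. a $ i * v $ i) \<le> (\<Sum>i\<in>UNIV. \<bar>cmod (a $ i)\<bar> * \<bar>cmod (v $ i)\<bar>)"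
    by (rule order_trans [OF norm_sum]) (simp add: norm_mult)
  also have "\<dots> \<le> norm a * norm v"
    unfolding norm_vec_def by (rule L2_set_mult_ineq)
  finally show ?thesis .
qed

lemma norm_mult_le_spectral_norm: "norm (A *v x) \<le> spectral_norm A * norm x"
  unfolding spectral_norm_def by (rule onorm) simp

lemma spectral_norm_rank_one_le:
  fixes b c :: "complex^'n"
  shows "spectral_norm (\<chi> i k. b $ i * c $ k) \<le> norm b * norm c"
  unfolding spectral_norm_def
proof (rule onorm_le)
  fix v :: "complex^'n"
  have "(\<chi> i k. b $ i * c $ k) *v v = (\<Sum>k\<in>UNIV. c $ k * v $ k) *s b"
    by (simp add: vec_eq_iff matrix_vector_mult_def sum_distrib_left mult_ac)
  then have "norm ((\<chi> i k. b $ i * c $ k) *v v) = cmod (\<Sum>k\<in>UNIV. c $ k * v $ k) * norm b"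
    by (simp add: norm_scaled_vec)
  also have "\<dots> \<le> norm c * norm v * norm b"
    by (intro mult_right_mono cmod_sum_mult_le) simp
  finally show "norm ((\<chi> i k. b $ i * c $ k) *v v) \<le> norm b * norm c * norm v"
    by (simp add: mult_ac)
qed

lemma matrix_cond_ge_1:
  fixes A :: "complex^'n^'n"
  assumes "det A \<noteq> 0"
  shows "matrix_cond A \<ge> 1"
proof -
  obtain x :: "complex^'n" where x: "norm x = 1"
    by (rule vector_choose_size [of 1]) auto
  have inv: "A ** matrix_inv A = mat 1"
    using assms unfolding invertible_det_nz [symmetric] invertible_def matrix_inv_def
    by (rule someI2_ex) simp
  have "1 = norm (A *v (matrix_inv A *v x))"
    by (simp add: matrix_vector_mul_assoc inv x)
  also have "\<dots> \<le> spectral_norm A * norm (matrix_inv A *v x)"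
    by (rule norm_mult_le_spectral_norm)
  also have "\<dots> \<le> spectral_norm A * (spectral_norm (matrix_inv A) * norm x)"
    by (intro mult_left_mono norm_mult_le_spectral_norm) (simp add: spectral_norm_def onorm_pos_le)
  finally show ?thesis by (simp add: x matrix_cond_def)
qed

section \<open>Perturbing the coefficients of a matrix polynomial\<close>

lemma matpoly_add_scaled:
  assumes "degree g \<le> m"
  shows "matpoly m (\<lambda>j. A j + (\<chi> i k. coeff g j * R $ i $ k))
    = (\<chi> i k. matpoly m A $ i $ k + smult (R $ i $ k) g)"
proof -
  have "(\<Sum>j\<le>m. monom (coeff g j * r) j) = smult r g" for r
    using assms by (intro poly_eqI) (auto simp: coeff_sum coeff_eq_0)
  then show ?thesis
    by (simp add: matpoly_def vec_eq_iff sum.distrib flip: add_monom)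
qed

text \<open>The perturbation is \<open>g(\<lambda>) R\<close> with \<open>R = b c\<close> the rank-one matrix that agrees with \<open>P(z)\<close> on
  \<open>v\<close>, and \<open>g(z) = -1\<close>. Since \<open>y\<^sup>* b = y\<^sup>* P(z) v = 0\<close>, the product \<open>y\<^sup>* R\<close> vanishes, so neither
  \<open>y\<^sup>* P(z)\<close> nor \<open>y\<^sup>* P'(z)\<close> changes.\<close>

lemma matpoly_with_multiple_eigenvalue_nearby:
  fixes A :: "nat \<Rightarrow> complex^'n^'n"
  assumes w: "\<And>j. j \<le> m \<Longrightarrow> w j \<ge> 0" and W: "weight_poly m w (cmod z) > 0"
    and y: "left_eigenvector (matpoly m A) z y" and v: "v \<noteq> 0"
    and yv: "sesq_form y (mp_eval (mp_deriv (matpoly m A)) z) v = 0"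
    and e: "norm (mp_eval (matpoly m A) z *v v) / norm v \<le> e * weight_poly m w (cmod z)"
  shows "\<exists>Q \<in> pert_ball m A e w. multiple_eigenvalue Q z"
proof -
  let ?P = "matpoly m A" and ?W = "weight_poly m w (cmod z)"
  define b where "b = mp_eval ?P z *v v"
  define c where "c = inverse (of_real ((norm v)\<^sup>2)) *s vec_cnj v"
  \<comment> \<open>The phases turn every \<open>z ^ j\<close> into \<open>cmod z ^ j\<close>, so the weighted sum is exactly \<open>- ?W / ?W\<close>.
    For \<open>z = 0\<close> they vanish except at \<open>j = 0\<close>, where \<open>0 ^ 0 = 1\<close>.\<close>
  define g where "g = (\<Sum>j\<le>m. monom (- (w j / ?W) * cnj (sgn z) ^ j) j)"
  have coeff_g: "coeff g j = - (w j / ?W) * cnj (sgn z) ^ j" if "j \<le> m" for j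
    using that by (simp add: g_def coeff_sum)
  have deg: "degree g \<le> m"
    by (auto simp: g_def intro!: degree_sum_le order_trans [OF degree_monom_le])
  have turn: "cnj (sgn z) * z = of_real (cmod z)"
    using complex_norm_square [of z]
    by (cases "z = 0") (simp_all add: sgn_eq power2_eq_square field_simps)
  have gz: "poly g z = -1"
  proof -
    have "poly g z = (\<Sum>j\<le>m. - of_real (w j / ?W) * (cnj (sgn z) * z) ^ j)"
      by (simp add: g_def poly_sum poly_monom power_mult_distrib mult_ac)
    also have "\<dots> = - of_real (?W / ?W)"
      unfolding turn
      by (subst (2) weight_poly_def) (simp add: sum_negf sum_divide_distrib)
    finally show ?thesis using W by simp
  qed
  define R where "R = (\<chi> i k. b $ i * c $ k)"
  define Q where "Q = matpoly m (\<lambda>j. A j + (\<chi> i k. coeff g j * R $ i $ k))"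
  have Q: "Q = (\<chi> i k. ?P $ i $ k + smult (R $ i $ k) g)"
    unfolding Q_def by (rule matpoly_add_scaled [OF deg])
  have evQ: "mp_eval Q z = mp_eval ?P z - R"
    by (simp add: Q mp_eval_def vec_eq_iff gz)
  have devQ: "mp_eval (mp_deriv Q) z = mp_eval (mp_deriv ?P) z + (\<chi> i k. poly (pderiv g) z * R $ i $ k)"
    by (simp add: Q mp_eval_def mp_deriv_def vec_eq_iff pderiv_add pderiv_smult mult_ac)
  have cv: "(\<Sum>k\<in>UNIV. c $ k * v $ k) = 1"
  proof -
    have "(\<Sum>k\<in>UNIV. c $ k * v $ k)
        = inverse (of_real ((norm v)\<^sup>2)) * (\<Sum>k\<in>UNIV. v $ k * cnj (v $ k))"
      by (simp add: c_def vec_cnj_def sum_distrib_left mult_ac)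
    then show ?thesis using v by (simp add: sum_mult_cnj_eq_norm_square)
  qed
  have Rv: "R *v v = b"
  proof -
    have "(R *v v) $ i = b $ i * (\<Sum>k\<in>UNIV. c $ k * v $ k)" for i
      by (simp add: R_def matrix_vector_mult_def sum_distrib_left mult_ac)
    then show ?thesis by (simp add: vec_eq_iff cv)
  qed
  have yb: "(\<Sum>i\<in>UNIV. vec_cnj y $ i * b $ i) = 0"
  proof -
    have "(\<Sum>i\<in>UNIV. vec_cnj y $ i * b $ i)
        = (\<Sum>k\<in>UNIV. star_mult y (mp_eval ?P z) $ k * v $ k)"
      unfolding b_def star_mult_def matrix_vector_mult_def vector_matrix_mult_def
      by (simp add: sum_distrib_left sum_distrib_right mult_ac)
        (rule sum.swap)
    also have "\<dots> = 0" using y by (simp add: left_eigenvector_def)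
    finally show ?thesis .
  qed
  have yR: "star_mult y (\<chi> i k. s * R $ i $ k) = 0" for s
  proof -
    have "star_mult y (\<chi> i k. s * R $ i $ k) $ k
        = s * c $ k * (\<Sum>i\<in>UNIV. vec_cnj y $ i * b $ i)" for k
      by (simp add: star_mult_def R_def vector_matrix_mult_def sum_distrib_left mult_ac)
    then show ?thesis by (simp add: vec_eq_iff yb)
  qed
  have star_add: "star_mult y (M + N) = star_mult y M + star_mult y N" for M N
    by (simp add: star_mult_def vector_matrix_mult_add_rdistrib vector_matrix_left_distrib)
  have "multiple_eigenvalue Q z"
  proof (rule multiple_eigenvalueI)
    show "right_eigenvector Q z v"
      using v by (simp add: right_eigenvector_def evQ matrix_vector_mult_diff_rdistrib Rv b_def)
    have "mp_eval Q z = mp_eval ?P z + (\<chi> i k. -1 * R $ i $ k)"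
      by (simp add: evQ vec_eq_iff)
    then show "left_eigenvector Q z y"
      using y yR [of "-1"] by (simp add: left_eigenvector_def star_add)
    show "sesq_form y (mp_eval (mp_deriv Q) z) v = 0"
      using yv by (simp add: devQ sesq_form_def star_add yR)
  qed
  moreover have "Q \<in> pert_ball m A e w"
    unfolding pert_ball_def Q_def
  proof (intro CollectI exI [of _ "\<lambda>j. \<chi> i k. coeff g j * R $ i $ k"] conjI refl allI impI)
    fix j assume j: "j \<le> m"
    have norm_c: "norm c = 1 / norm v"
    proof -
      have "norm c = inverse ((norm v)\<^sup>2) * norm v"
        by (simp add: c_def norm_scaled_vec norm_vec_cnj norm_inverse norm_power)
      then show ?thesis using v by (simp add: power2_eq_square field_simps)
    qed
    have sgn1: "cmod (cnj (sgn z) ^ j) \<le> 1"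
      by (simp add: norm_power power_le_one norm_sgn)
    have "(\<chi> i k. coeff g j * R $ i $ k) = (\<chi> i k. (coeff g j *s b) $ i * c $ k)"
      by (simp add: R_def mult_ac)
    then have "spectral_norm (\<chi> i k. coeff g j * R $ i $ k) \<le> norm (coeff g j *s b) * norm c"
      by (metis spectral_norm_rank_one_le)
    also have "\<dots> = cmod (coeff g j) * (norm b / norm v)"
      by (simp add: norm_scaled_vec norm_c)
    also have "\<dots> \<le> (w j / ?W) * (e * ?W)"
    proof (rule mult_mono)
      have "cmod (coeff g j) = w j / ?W * cmod (cnj (sgn z) ^ j)"
        using w [OF j] W by (simp add: coeff_g [OF j] norm_mult norm_divide)
      also have "\<dots> \<le> w j / ?W"
        using w [OF j] W by (intro mult_left_le sgn1) simp
      finally show "cmod (coeff g j) \<le> w j / ?W" .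
      show "norm b / norm v \<le> e * ?W" using e by (simp add: b_def)
    qed (use w [OF j] W in simp_all)
    also have "\<dots> = e * w j" using W by simp
    finally show "spectral_norm (\<chi> i k. coeff g j * R $ i $ k) \<le> e * w j" .
  qed
  ultimately show ?thesis by blast
qed

section \<open>The distance to a multiple eigenvalue\<close>

theorem theorem4:
  fixes A :: "nat \<Rightarrow> complex^'n^'n"
    and P :: "(complex poly)^'n^'n"
    and w :: "nat \<Rightarrow> real"
    and m :: nat
    and z0 :: complex
    and x0 y0 :: "complex^'n"
  assumes "m \<ge> 1"
    and "P = matpoly m A"
    and "det (A m) \<noteq> 0"
    and "w 0 > 0"
    and "\<forall>j\<in>{1..m}. w j \<ge> 0"
    and "z0 \<in> mp_spectrum P - mp_spectrum (mp_deriv P)"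
    and "simple_eigenvalue P z0"
    and "left_eigenvector P z0 y0" and "norm y0 = 1"
    and "right_eigenvector P z0 x0" and "norm x0 = 1"
    and "\<not> (\<exists>c. adjoint_mat (mp_eval (mp_deriv P) z0) *v y0 = c *s x0)"
  shows "dist_multiple m A w z0 \<le>
    ereal (matrix_cond (mp_eval (mp_deriv P) z0) * spectral_norm (mp_eval P z0) /
      (eig_cond m w P z0 x0 y0 *
        sqrt ((norm (star_mult y0 (mp_eval (mp_deriv P) z0)))\<^sup>2
          - (cmod (sesq_form y0 (mp_eval (mp_deriv P) z0) x0))\<^sup>2)))"
proof -
  let ?B = "mp_eval P z0" and ?C = "mp_eval (mp_deriv P) z0"
  let ?W = "weight_poly m w (cmod z0)"
  define a where "a = star_mult y0 ?C"
  define \<beta> where "\<beta> = sesq_form y0 ?C x0"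
  \<comment> \<open>\<open>v\<close> is the component of \<open>x0\<close> orthogonal to \<open>vec_cnj a\<close>.\<close>
  define \<gamma> where "\<gamma> = \<beta> / of_real ((norm a)\<^sup>2)"
  define v where "v = x0 - \<gamma> *s vec_cnj a"
  have adj: "adjoint_mat ?C *v y0 = vec_cnj a"
    by (simp add: a_def star_mult_def adjoint_mat_def vec_cnj_def vec_eq_iff
        matrix_vector_mult_def vector_matrix_mult_def mult_ac)
  have not_parallel: "vec_cnj a \<noteq> c *s x0" for c
    using assms(12) by (simp add: adj)
  have a: "norm a > 0"
  proof -
    have "vec_cnj a \<noteq> 0"
      using not_parallel [of 0] by simp
    then show ?thesis by (auto simp: vec_cnj_def vec_eq_iff)
  qed
  have \<beta>: "\<beta> = (\<Sum>i\<in>UNIV. a $ i * x0 $ i)"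
    by (simp add: \<beta>_def a_def sesq_form_def)
  have av: "(\<Sum>i\<in>UNIV. a $ i * v $ i) = 0"
  proof -
    have "(\<Sum>i\<in>UNIV. a $ i * v $ i)
        = (\<Sum>i\<in>UNIV. a $ i * x0 $ i) - \<gamma> * (\<Sum>i\<in>UNIV. a $ i * cnj (a $ i))"
      by (simp add: v_def vec_cnj_def sum_subtractf sum_distrib_left algebra_simps)
    also have "\<dots> = 0"
      using a by (simp add: sum_mult_cnj_eq_norm_square \<gamma>_def flip: \<beta>)
    finally show ?thesis .
  qed
  have "v \<noteq> 0"
  proof
    assume "v = 0"
    then have x0: "x0 = (\<beta> / of_real ((norm a)\<^sup>2)) *s vec_cnj a"
      by (simp add: v_def \<gamma>_def)
    then have "\<beta> \<noteq> 0"
      using assms(11) by auto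
    have "vec_cnj a = (of_real ((norm a)\<^sup>2) / \<beta>) *s x0"
      by (subst x0) (use a \<open>\<beta> \<noteq> 0\<close> in simp)
    with not_parallel show False by blast
  qed
  have "(norm v)\<^sup>2 = 1 - (cmod \<beta>)\<^sup>2 / (norm a)\<^sup>2"
  proof -
    have "complex_of_real ((norm v)\<^sup>2) = (\<Sum>i\<in>UNIV. v $ i * cnj (v $ i))"
      by (simp only: sum_mult_cnj_eq_norm_square)
    also have "\<dots> = (\<Sum>i\<in>UNIV. v $ i * cnj (x0 $ i))
        - cnj \<gamma> * (\<Sum>i\<in>UNIV. a $ i * v $ i)"
      by (simp add: v_def vec_cnj_def sum_subtractf sum.distrib sum_distrib_left algebra_simps)
    also have "\<dots> = (\<Sum>i\<in>UNIV. x0 $ i * cnj (x0 $ i))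
        - \<gamma> * cnj (\<Sum>i\<in>UNIV. a $ i * x0 $ i)"
      unfolding av
      by (simp add: v_def vec_cnj_def sum_subtractf sum.distrib sum_distrib_left algebra_simps)
    also have "\<dots> = of_real (1 - (cmod \<beta>)\<^sup>2 / (norm a)\<^sup>2)"
      using complex_norm_square [of \<beta>]
      by (simp add: sum_mult_cnj_eq_norm_square assms(11) \<gamma>_def flip: \<beta>)
    finally show ?thesis using of_real_eq_iff by blast
  qed
  then have s: "sqrt ((norm a)\<^sup>2 - (cmod \<beta>)\<^sup>2) = norm a * norm v"
    using a by (intro real_sqrt_unique) (simp_all add: power_mult_distrib field_simps)
  have Bv: "norm (?B *v v) / norm v \<le> cmod \<beta> * spectral_norm ?B / (norm a * norm v)"
  proof -
    have "?B *v v = - ((\<beta> / of_real ((norm a)\<^sup>2)) *s (?B *v vec_cnj a))"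
      using assms(10)
      by (simp add: v_def \<gamma>_def right_eigenvector_def matrix_vector_mult_diff_distrib vector_scalar_commute)
    then have "norm (?B *v v) = cmod \<beta> / (norm a)\<^sup>2 * norm (?B *v vec_cnj a)"
      by (simp add: norm_scaled_vec norm_divide norm_power)
    also have "\<dots> \<le> cmod \<beta> / (norm a)\<^sup>2 * (spectral_norm ?B * norm a)"
      by (intro mult_left_mono) (use norm_mult_le_spectral_norm [of ?B "vec_cnj a"] in \<open>simp_all add: norm_vec_cnj\<close>)
    also have "\<dots> = cmod \<beta> * spectral_norm ?B / norm a"
      using a by (simp add: power2_eq_square)
    finally have "norm (?B *v v) / norm v \<le> cmod \<beta> * spectral_norm ?B / norm a / norm v"
      by (rule divide_right_mono) simp
    then show ?thesis by simp
  qed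
  have w: "w j \<ge> 0" if "j \<le> m" for j
  proof (cases "j = 0")
    case False
    with that have "j \<in> {1..m}" by simp
    then show ?thesis using assms(5) by (rule bspec [rotated])
  qed (use assms(4) in simp)
  have W: "?W > 0"
    unfolding weight_poly_def
    by (rule sum_pos2 [of _ 0]) (use assms(4) w in auto)
  let ?r = "cmod \<beta> * spectral_norm ?B / (norm a * norm v)"
  let ?R = "matrix_cond ?C * spectral_norm ?B / (eig_cond m w P z0 x0 y0 * (norm a * norm v))"
  have r0: "?r \<ge> 0"
    by (simp add: spectral_norm_def onorm_pos_le)
  have R: "?R = matrix_cond ?C * (?r / ?W)"
    by (simp add: eig_cond_def assms(9,11) \<beta>_def mult_ac)
  have "1 \<le> matrix_cond ?C"
    using assms(6) by (intro matrix_cond_ge_1) (simp add: mp_spectrum_def)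
  moreover have "0 \<le> ?r / ?W"
    by (rule divide_nonneg_pos [OF r0 W])
  ultimately have R_ge: "?r / ?W \<le> ?R"
    unfolding R using mult_right_mono [of 1 "matrix_cond ?C" "?r / ?W"] by simp
  \<comment> \<open>Radii have to be positive. Working with the numbers above \<open>?R \<ge> 0\<close> avoids a separate
    argument that \<open>?R\<close> is nonzero.\<close>
  have larger: "dist_multiple m A w z0 \<le> ereal e" if e: "?R < e" for e
  proof -
    have e': "?r / ?W < e" using R_ge e by linarith
    moreover have "0 \<le> ?r / ?W" by (rule divide_nonneg_pos [OF r0 W])
    ultimately have "0 < e" by linarith
    have "norm (?B *v v) / norm v \<le> e * ?W"
      using Bv e' unfolding pos_divide_less_eq [OF W] by linarith
    then have "\<exists>Q \<in> pert_ball m A e w. multiple_eigenvalue Q z0"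
      unfolding assms(2)
      by (intro matpoly_with_multiple_eigenvalue_nearby [OF w W _ \<open>v \<noteq> 0\<close>])
        (use assms(8) av in \<open>simp_all only: sesq_form_def a_def assms(2)\<close>)
    with \<open>0 < e\<close> show ?thesis
      unfolding dist_multiple_def by (intro INF_lower) simp
  qed
  have "dist_multiple m A w z0 \<le> ereal ?R + ereal \<delta>" if "0 < \<delta>" for \<delta>
    unfolding plus_ereal.simps by (rule larger) (use that in linarith)
  then have "dist_multiple m A w z0 \<le> ereal ?R"
    by (rule ereal_le_epsilon2)
  then show ?thesis
    unfolding s [symmetric] by (simp only: a_def \<beta>_def)
qed

end
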